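(* Let $a$ be a positive integer with $a\equiv 1\pmod{8}$. If $n$ is an odd positive integer and $a^n+1$ is the sum of two squares, then $a^{\delta}+1$ is the sum of two squares for all positive divisors $\delta$ of $n$.
   Context: An integer $N$ is "the sum of two squares" if $N = s^2+t^2$ for some integers $s,t$ (zero is allowed). *)

theory Defs
  imports "HOL-Number_Theory.Number_Theory"
begin

definition sum_of_two_squares :: "int \<Rightarrow> bool" where
  "sum_of_two_squares N \<longleftrightarrow> (\<exists>s t :: int. N = s^2 + t^2)"

end

theory Submission
  imports Defs "HOL-Computational_Algebra.Nth_Powers"
begin

text \<open>
  Write \<open>n = \<delta> * m\<close> and \<open>x = a ^ \<delta>\<close>; the task is to pass from \<open>x ^ m + 1\<close> to
  \<open>x + 1\<close>, and since powers of \<open>x\<close> remain congruent to 1 modulo 8 it can be done one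
  prime factor \<open>p\<close> of \<open>m\<close> at a time. So let \<open>x ^ p + 1 = (x + 1) * Q\<close> be a sum of two
  squares, where \<open>Q = (\<Sum>i<p. (- x) ^ i)\<close>.

  The main tool is that positive coprime factors of a sum of two squares are themselves
  sums of two squares (\<open>sum_of_two_squares_coprime_factor\<close>). As \<open>- x\<close> is 1 modulo
  \<open>x + 1\<close>, \<open>Q\<close> is congruent to \<open>p\<close> modulo \<open>x + 1\<close>, so if \<open>p\<close> does not divide
  \<open>x + 1\<close> the two factors are coprime and \<open>x + 1\<close> is a sum of two squares.

  If \<open>p\<close> divides \<open>x + 1\<close>, then expanding \<open>Q\<close> modulo \<open>(x + 1)\<^sup>2\<close> shows that
  \<open>Q = p * Q'\<close> with \<open>Q'\<close> coprime to \<open>p * (x + 1)\<close>. Hence both \<open>Q'\<close> and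
  \<open>p * (x + 1)\<close> are sums of two squares. Here the hypothesis modulo 8 enters: from
  \<open>(x + 1) * Q = x ^ p + 1\<close>, with \<open>x + 1\<close> and \<open>x ^ p + 1\<close> both congruent to 2 modulo 8,
  it follows that \<open>Q\<close> is 1 modulo 4. The odd sum of two squares \<open>Q'\<close> is also 1 modulo 4,
  and therefore so is \<open>p\<close>. Then \<open>p\<close> is a sum of two squares and can be cancelled
  from \<open>p * (x + 1)\<close> (\<open>sum_of_two_squares_cancel_prime\<close>).
\<close>

section \<open>Divisors of a sum of two squares\<close>

text \<open>
  Thue's pigeonhole argument. A collision of \<open>i - c * j\<close> modulo \<open>N\<close>, for \<open>i\<close> and \<open>j\<close>
  up to the integer square root of \<open>N\<close>, gives \<open>x\<^sup>2 + y\<^sup>2 = N * m\<close> with \<open>m\<close> equal to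
  1 or 2, and a factor 2 can be removed.
\<close>

lemma dvd_square_plus_one_imp_sum_of_two_squares:
  fixes N c :: int
  assumes N: "N > 0" and c: "N dvd c\<^sup>2 + 1"
  shows "sum_of_two_squares N"
proof -
  define k where "k = \<lfloor>sqrt (real_of_int N)\<rfloor>"
  have k0: "k \<ge> 0" unfolding k_def using N by simp
  have kle: "k\<^sup>2 \<le> N"
  proof -
    have "real_of_int k \<le> sqrt N" unfolding k_def by linarith
    hence "(real_of_int k)\<^sup>2 \<le> (sqrt N)\<^sup>2" using k0 by (intro power_mono) auto
    hence "real_of_int (k\<^sup>2) \<le> real_of_int N" using N by simp
    thus ?thesis by linarith
  qed
  have klt: "N < (k + 1)\<^sup>2"
  proof -
    have "sqrt N < real_of_int (k + 1)" unfolding k_def by linarith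
    hence "(sqrt N)\<^sup>2 < (real_of_int (k + 1))\<^sup>2" using N by (intro power_strict_mono) auto
    hence "real_of_int N < real_of_int ((k + 1)\<^sup>2)" using N by simp
    thus ?thesis by linarith
  qed
  define A where "A = {0..k} \<times> {0..k}"
  define f where "f = (\<lambda>(i, j). (i - c * j) mod N)"
  have "int (card (f ` A)) \<le> int (card {0..<N})"
    unfolding f_def using N by (intro of_nat_mono card_mono) auto
  also have "\<dots> < int (card A)"
    using klt k0 N by (simp add: A_def card_cartesian_product power2_eq_square nat_mult_distrib)
  finally have "\<not> inj_on f A" by (intro pigeonhole) simp
  then obtain i j i' j' where ij: "(i, j) \<in> A" "(i', j') \<in> A" "(i, j) \<noteq> (i', j')"
    "f (i, j) = f (i', j')"
    by (auto simp: inj_on_def)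
  define x y where "x = i - i'" and "y = j - j'"
  have bounds: "\<bar>x\<bar> \<le> k" "\<bar>y\<bar> \<le> k" and nz: "x \<noteq> 0 \<or> y \<noteq> 0"
    using ij by (auto simp: A_def x_def y_def)
  have "N dvd x - c * y"
    using ij(4) by (simp add: f_def x_def y_def mod_eq_dvd_iff algebra_simps)
  hence "N dvd (x - c * y) * (x + c * y) + (c\<^sup>2 + 1) * y\<^sup>2"
    using c by (intro dvd_add[OF dvd_mult2 dvd_mult2])
  also have "(x - c * y) * (x + c * y) + (c\<^sup>2 + 1) * y\<^sup>2 = x\<^sup>2 + y\<^sup>2"
    by (simp add: algebra_simps power2_eq_square)
  finally obtain m where m: "x\<^sup>2 + y\<^sup>2 = N * m" by (rule dvdE)
  have "x\<^sup>2 \<le> k\<^sup>2" "y\<^sup>2 \<le> k\<^sup>2" using bounds k0 by (auto simp: abs_le_square_iff[symmetric])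
  hence "N * m \<le> N * 2" using m kle by simp
  hence "m \<le> 2" using N by (simp only: mult_le_cancel_left_pos)
  moreover have "N * m > 0" using nz m by (metis sum_power2_gt_zero_iff)
  hence "m > 0" using N by (simp add: zero_less_mult_iff)
  ultimately consider "m = 1" | "m = 2" by linarith
  thus ?thesis
  proof cases
    case 1
    thus ?thesis using m unfolding sum_of_two_squares_def by (metis mult.right_neutral)
  next
    case 2
    have "even (x\<^sup>2 + y\<^sup>2)" using m 2 by simp
    hence "even (x + y)" by simp
    then obtain u where u: "x + y = 2 * u" by (rule evenE)
    \<comment> \<open>Half of \<open>x\<^sup>2 + y\<^sup>2\<close> is the sum of the squares of \<open>(x + y) / 2\<close> and \<open>(x - y) / 2\<close>.\<close>
    have x: "x = 2 * u - y" using u by simp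
    have "N = u\<^sup>2 + (u - y)\<^sup>2"
      using m 2 unfolding x by (simp add: algebra_simps power2_eq_square)
    thus ?thesis unfolding sum_of_two_squares_def by blast
  qed
qed

lemma coprime_add_mult_left_iff:
  fixes a z w :: int
  shows "coprime (a + z * w) z \<longleftrightarrow> coprime a z"
proof -
  have "gcd (a + z * w) z = gcd z (w * z + a)"
    by (simp only: gcd.commute[of z] mult.commute[of w] add.commute[of _ a])
  also have "\<dots> = gcd a z" by (simp only: gcd_add_mult gcd.commute[of z])
  finally show ?thesis by (simp only: coprime_iff_gcd_eq_1)
qed

text \<open>
  Coprimality makes \<open>t\<close> invertible modulo \<open>u\<close>, and then \<open>s / t\<close> is a square root
  of \<open>- 1\<close> modulo \<open>u\<close>.
\<close>

lemma dvd_coprime_sum_squares_imp_sum_of_two_squares: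
  fixes s t u :: int
  assumes st: "coprime s t" and u: "u > 0" "u dvd s\<^sup>2 + t\<^sup>2"
  shows "sum_of_two_squares u"
proof -
  have "coprime (s\<^sup>2) t" using st by simp
  hence "coprime (s\<^sup>2 + t\<^sup>2) t"
    by (simp only: power2_eq_square[of t] coprime_add_mult_left_iff)
  hence "coprime t (s\<^sup>2 + t\<^sup>2)" by (simp only: coprime_commute)
  hence "coprime t u" by (rule coprime_divisors[OF dvd_refl u(2)])
  then obtain r where r: "[t * r = 1] (mod u)" by (rule cong_solve_coprime_int[THEN exE])
  have "[1\<^sup>2 = (t * r)\<^sup>2] (mod u)" using r by (intro cong_pow) (rule cong_sym)
  hence "[(s * r)\<^sup>2 + 1 = (s * r)\<^sup>2 + (t * r)\<^sup>2] (mod u)"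
    by (intro cong_add cong_refl) simp
  also have "(s * r)\<^sup>2 + (t * r)\<^sup>2 = r\<^sup>2 * (s\<^sup>2 + t\<^sup>2)"
    by (simp add: algebra_simps power_mult_distrib)
  finally have "u dvd (s * r)\<^sup>2 + 1" using u(2) by (simp add: cong_dvd_iff)
  thus ?thesis using u(1) by (intro dvd_square_plus_one_imp_sum_of_two_squares)
qed

lemma sum_of_two_squares_square_mult:
  assumes "sum_of_two_squares N"
  shows "sum_of_two_squares (e\<^sup>2 * N)"
proof -
  obtain s t where "N = s\<^sup>2 + t\<^sup>2" using assms unfolding sum_of_two_squares_def by blast
  hence "e\<^sup>2 * N = (e * s)\<^sup>2 + (e * t)\<^sup>2" by (simp add: distrib_left power_mult_distrib)
  thus ?thesis unfolding sum_of_two_squares_def by blast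
qed

lemma coprime_mult_square_imp_squareE:
  fixes b c d :: int
  assumes "coprime b c" "b * c = d\<^sup>2" "b > 0" "c > 0"
  obtains e where "b = e\<^sup>2"
proof -
  have "nat b * nat c = nat \<bar>d\<bar> ^ 2"
    using assms(2-4) by (subst of_nat_eq_iff[where 'a = int, symmetric]) simp
  moreover have "coprime (nat b) (nat c)"
    using assms by (simp flip: coprime_int_iff)
  ultimately have "is_nth_power 2 (nat b)"
    using assms is_nth_power_mult_coprime_natD(1)[of "nat b" "nat c" 2]
    by (auto simp: is_nth_power_def)
  then obtain e where "nat b = e ^ 2" by (auto simp: is_nth_power_def)
  hence "b = (int e)\<^sup>2" using assms by (metis int_nat_eq less_imp_le of_nat_power)
  thus thesis by (rule that)
qed

text \<open>
  Let \<open>d = gcd s t\<close> in \<open>u * v = s\<^sup>2 + t\<^sup>2\<close>. As \<open>u\<close> and \<open>v\<close> are coprime, \<open>d\<^sup>2\<close>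
  splits into coprime parts dividing \<open>u\<close> and \<open>v\<close>, each of which is a square. What is
  left of \<open>u\<close> divides a sum of two coprime squares.
\<close>

lemma sum_of_two_squares_coprime_factor:
  fixes u v :: int
  assumes "coprime u v" "u > 0" "v > 0" "sum_of_two_squares (u * v)"
  shows "sum_of_two_squares u"
proof -
  from assms(4) obtain s t where st: "u * v = s\<^sup>2 + t\<^sup>2"
    unfolding sum_of_two_squares_def by blast
  define d where "d = gcd s t"
  have "s \<noteq> 0 \<or> t \<noteq> 0" using st assms by auto
  then obtain s' t' where s't': "s = s' * d" "t = t' * d" "coprime s' t'"
    unfolding d_def using gcd_coprime_exists[of s t] by auto
  have d: "d > 0" using \<open>s \<noteq> 0 \<or> t \<noteq> 0\<close> by (auto simp: d_def)
  have uv: "u * v = d\<^sup>2 * (s'\<^sup>2 + t'\<^sup>2)"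
    using st s't' by (simp add: algebra_simps power_mult_distrib)
  have "d\<^sup>2 dvd u * v" by (simp only: uv dvd_triv_left)
  \<comment> \<open>The decomposition over the integers leaves the signs of the two parts open.\<close>
  then obtain b\<^sub>0 c\<^sub>0 where bc\<^sub>0: "d\<^sup>2 = b\<^sub>0 * c\<^sub>0" "b\<^sub>0 dvd u" "c\<^sub>0 dvd v"
    using division_decomp by blast
  define b c where "b = \<bar>b\<^sub>0\<bar>" and "c = \<bar>c\<^sub>0\<bar>"
  have "b\<^sub>0 \<noteq> 0" "c\<^sub>0 \<noteq> 0" using bc\<^sub>0(1) d by (metis mult_zero_left mult_zero_right power_eq_0_iff less_irrefl)+
  hence bc: "b > 0" "c > 0" "b dvd u" "c dvd v" using bc\<^sub>0(2,3) by (simp_all add: b_def c_def)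
  have "coprime b c" using assms(1) by (rule coprime_divisors[OF bc(3,4)])
  have "b * c = d\<^sup>2" by (simp add: b_def c_def bc\<^sub>0(1)[symmetric] flip: abs_mult)
  then obtain e where e: "b = e\<^sup>2"
    using coprime_mult_square_imp_squareE \<open>coprime b c\<close> bc by blast
  obtain u' v' where u': "u = b * u'" "v = c * v'" using bc by (auto elim!: dvdE)
  have "d\<^sup>2 * (u' * v') = u * v"
    by (simp only: u' \<open>b * c = d\<^sup>2\<close>[symmetric] ac_simps)
  hence "d\<^sup>2 * (u' * v') = d\<^sup>2 * (s'\<^sup>2 + t'\<^sup>2)" by (simp only: uv)
  hence "u' * v' = s'\<^sup>2 + t'\<^sup>2" using d by simp
  hence "u' dvd s'\<^sup>2 + t'\<^sup>2" by (metis dvd_triv_left)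
  moreover have "u' > 0" using u' assms bc by (simp add: zero_less_mult_iff)
  ultimately have "sum_of_two_squares u'"
    using s't'(3) dvd_coprime_sum_squares_imp_sum_of_two_squares by blast
  thus ?thesis using sum_of_two_squares_square_mult u' e by blast
qed

section \<open>Primes and residues modulo 4\<close>

lemma prime_cong_1_mod_4_imp_sum_of_two_squares:
  fixes p :: nat
  assumes "prime p" "p mod 4 = 1"
  shows "sum_of_two_squares (int p)"
proof -
  have p: "p > 2" using assms prime_gt_1_nat[of p] by (cases "p = 2") auto
  have "even ((p - 1) div 2)" using assms(2) by presburger
  hence "[Legendre (-1) p = 1] (mod p)"
    using euler_criterion[of p "-1"] assms(1) p by simp
  moreover have "\<not> [-1 = 1] (mod int p)" "\<not> [0 = 1] (mod int p)"
    using p by (auto simp: cong_iff_dvd_diff zdvd_not_zless dest: zdvd_imp_le)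
  ultimately have "QuadRes p (-1)" unfolding Legendre_def by (auto split: if_splits)
  then obtain y where "[y\<^sup>2 = -1] (mod int p)" unfolding QuadRes_def by auto
  hence "int p dvd y\<^sup>2 + 1" by (simp add: cong_iff_dvd_diff)
  thus ?thesis using p by (intro dvd_square_plus_one_imp_sum_of_two_squares) auto
qed

text \<open>
  With \<open>p = e\<^sup>2 + f\<^sup>2\<close> and \<open>p * w = s\<^sup>2 + t\<^sup>2\<close>, Brahmagupta's identity writes
  \<open>p * (p * w)\<close> as a sum of two squares in two ways, according to the sign of \<open>t\<close>.
  In one of them \<open>p\<close> divides both terms, so that \<open>p\<^sup>2\<close> can be divided out.
\<close>

lemma sum_of_two_squares_cancel_prime:
  fixes p w :: int
  assumes "prime p" "sum_of_two_squares p" "sum_of_two_squares (p * w)"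
  shows "sum_of_two_squares w"
proof -
  obtain e f s t where ef: "p = e\<^sup>2 + f\<^sup>2" and st: "p * w = s\<^sup>2 + t\<^sup>2"
    using assms unfolding sum_of_two_squares_def by blast
  have cancel: "sum_of_two_squares w"
    if g: "p * w = s\<^sup>2 + g\<^sup>2" and dvd: "p dvd s * e - g * f" for g
  proof -
    have brahmagupta: "(s * e - g * f)\<^sup>2 + (s * f + g * e)\<^sup>2 = p * (p * w)"
      unfolding g unfolding ef by (simp add: algebra_simps power2_eq_square)
    have "(s * f + g * e)\<^sup>2 = p * (p * w) - (s * e - g * f)\<^sup>2"
      using brahmagupta by linarith
    hence "p dvd (s * f + g * e)\<^sup>2" using dvd by (simp add: power2_eq_square)
    hence "p dvd s * f + g * e" using assms(1) prime_dvd_power by blast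
    then obtain y where y: "s * f + g * e = p * y" by (rule dvdE)
    obtain x where x: "s * e - g * f = p * x" using dvd by (rule dvdE)
    have "(p * p) * (x\<^sup>2 + y\<^sup>2) = (p * p) * w"
      using brahmagupta unfolding x y by (simp add: algebra_simps power2_eq_square)
    hence "w = x\<^sup>2 + y\<^sup>2" using assms(1) by (simp add: prime_gt_0_int)
    thus ?thesis unfolding sum_of_two_squares_def by blast
  qed
  have "(s * e - t * f) * (s * e + t * f) = s\<^sup>2 * p - f\<^sup>2 * (p * w)"
    unfolding st unfolding ef by (simp add: algebra_simps power2_eq_square)
  also have "p dvd \<dots>" by simp
  finally have "p dvd s * e - t * f \<or> p dvd s * e + t * f"
    using assms(1) prime_dvd_mult_iff by blast
  thus ?thesis using cancel[of t] cancel[of "- t"] st by auto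
qed

lemma odd_sum_of_two_squares_mod_4:
  assumes "sum_of_two_squares N" "odd N"
  shows "N mod 4 = 1"
proof -
  have sq: "z\<^sup>2 mod 4 = (if even z then 0 else 1)" for z :: int
  proof (cases "even z")
    case True
    then obtain w where "z = 2 * w" by (rule evenE)
    thus ?thesis by (simp add: power2_eq_square)
  next
    case False
    then obtain w where w: "z = 2 * w + 1" by (rule oddE)
    have "z\<^sup>2 = 1 + 4 * (w * w + w)" unfolding w by (simp add: algebra_simps power2_eq_square)
    also have "\<dots> mod 4 = 1" by presburger
    finally show ?thesis using False by simp
  qed
  obtain s t where N: "N = s\<^sup>2 + t\<^sup>2"
    using assms(1) unfolding sum_of_two_squares_def by blast
  have "N mod 4 = (s\<^sup>2 mod 4 + t\<^sup>2 mod 4) mod 4" unfolding N by (simp add: mod_simps)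
  thus ?thesis using assms(2) N by (auto simp: sq split: if_splits)
qed

section \<open>Descent from an odd power to its base\<close>

lemma power_one_plus_mod_square:
  fixes z :: int
  shows "z\<^sup>2 dvd (1 + z) ^ i - (1 + int i * z)"
proof (induction i)
  case (Suc i)
  have "(1 + z) ^ Suc i - (1 + int (Suc i) * z)
      = (1 + z) * ((1 + z) ^ i - (1 + int i * z)) + z\<^sup>2 * int i"
    by (simp add: algebra_simps power2_eq_square)
  thus ?case using Suc by (metis dvd_add dvd_mult dvd_triv_left)
qed simp

text \<open>
  This expansion controls the exact power of \<open>p\<close> in the geometric sum when
  \<open>p\<close> divides \<open>z\<close>: for odd \<open>p\<close> the sum is then \<open>p\<close> modulo \<open>p\<^sup>2\<close>.
\<close>

lemma sum_power_one_plus_mod_square: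
  fixes z :: int
  shows "z\<^sup>2 dvd (\<Sum>i<p. (1 + z) ^ i) - (int p + int p * (int p - 1) div 2 * z)"
proof -
  have "2 * (\<Sum>i<n. int i) = int n * (int n - 1)" for n
    by (induction n) (auto simp: algebra_simps)
  hence "(\<Sum>i<p. int i) = int p * (int p - 1) div 2" 
    by (metis nonzero_mult_div_cancel_left zero_neq_numeral)
  hence "(\<Sum>i<p. (1 + z) ^ i) - (int p + int p * (int p - 1) div 2 * z)
      = (\<Sum>i<p. (1 + z) ^ i - (1 + int i * z))"
    by (simp add: sum_subtractf sum.distrib flip: sum_distrib_right)
  thus ?thesis using power_one_plus_mod_square by (auto intro: dvd_sum)
qed

text \<open>
  Once \<open>p\<close> divides \<open>x + 1\<close>, the residues modulo 4 of \<open>Q\<close> and \<open>Q div p\<close> force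
  \<open>p\<close> to be 1 modulo 4; a prime congruent to 3 would leave \<open>Q div p\<close>, a sum of two
  squares, congruent to 3.
\<close>

lemma sum_of_two_squares_prime_power_plus_one:
  fixes x :: int and p :: nat
  assumes x: "x > 0" "[x = 1] (mod 8)" and p: "prime p" "odd p"
    and sq: "sum_of_two_squares (x ^ p + 1)"
  shows "sum_of_two_squares (x + 1)"
proof -
  define Q where "Q = (\<Sum>i<p. (- x) ^ i)"
  define z where "z = - (x + 1)"
  have xz: "- x = 1 + z" by (simp add: z_def)
  have fact: "x ^ p + 1 = (x + 1) * Q"
    using one_diff_power_eq[of "- x" p] p(2) by (simp add: Q_def add.commute)
  have "x ^ p + 1 > 0" using x by (simp add: add_pos_pos)
  hence Q_pos: "Q > 0" unfolding fact using x by (simp add: zero_less_mult_iff)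
  have Q_mod: "Q mod 4 = 1"
  proof -
    have "[x ^ p = 1 ^ p] (mod 8)" using x(2) by (rule cong_pow)
    hence "(x ^ p + 1) mod 8 = 2" unfolding cong_def by simp presburger
    moreover have "8 dvd x - 1" using x(2) by (simp add: cong_iff_dvd_diff)
    then obtain k where "x - 1 = 8 * k" by (rule dvdE)
    hence k: "x + 1 = 8 * k + 2" by simp
    \<comment> \<open>Since \<open>x + 1\<close> is even, one factor 2 is lost: modulo 8 becomes modulo 4.\<close>
    ultimately have "(8 * (k * Q) + 2 * Q) mod 8 = 2" unfolding fact k by (simp add: algebra_simps)
    thus ?thesis by presburger
  qed
  obtain k where k: "Q = int p + int p * ((int p - 1) div 2) * z + z\<^sup>2 * k"
  proof -
    obtain k where "(\<Sum>i<p. (1 + z) ^ i) - (int p + int p * (int p - 1) div 2 * z) = z\<^sup>2 * k"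
      using sum_power_one_plus_mod_square[of z p] by (rule dvdE)
    moreover have "int p * (int p - 1) div 2 = int p * ((int p - 1) div 2)"
      using p(2) by (simp add: div_mult_swap)
    ultimately show thesis using that[of k] unfolding Q_def xz by simp
  qed
  show ?thesis
  proof (cases "int p dvd x + 1")
    case False
    hence "coprime (int p) (x + 1)" using p(1) by (simp add: prime_imp_coprime)
    hence "coprime (int p) z" by (simp only: z_def coprime_minus_right_iff)
    moreover have "Q = int p + z * (int p * ((int p - 1) div 2) + z * k)"
      unfolding k by (simp add: algebra_simps power2_eq_square)
    ultimately have "coprime Q z" by (simp only: coprime_add_mult_left_iff)
    hence cop: "coprime (x + 1) Q" by (simp only: z_def coprime_minus_right_iff coprime_commute)
    show ?thesis
    proof (rule sum_of_two_squares_coprime_factor[OF cop])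
      show "sum_of_two_squares ((x + 1) * Q)" using sq by (simp only: fact)
    qed (use x Q_pos in simp_all)
  next
    case True
    hence "int p dvd z" by (simp only: z_def dvd_minus_iff)
    then obtain l where l: "z = int p * l" by (rule dvdE)
    define Q' where "Q' = 1 + z * ((int p - 1) div 2 + l * k)"
    have Q: "Q = int p * Q'" unfolding k Q'_def l by (simp add: algebra_simps power2_eq_square)
    have Q'_pos: "Q' > 0" using Q_pos Q p(1) by (simp add: zero_less_mult_iff)
    have "coprime Q' z" by (simp only: Q'_def coprime_add_mult_left_iff coprime_1_left)
    moreover have "coprime Q' (int p)" using calculation unfolding l by simp
    ultimately have cop: "coprime Q' (int p * (x + 1))"
      by (simp only: z_def coprime_minus_right_iff coprime_mult_right_iff)
    have eq: "x ^ p + 1 = Q' * (int p * (x + 1))" unfolding fact Q by simp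
    have pos: "int p * (x + 1) > 0" using x p(1) by (simp add: prime_gt_0_nat)
    have Q'_sq: "sum_of_two_squares Q'"
      using sum_of_two_squares_coprime_factor[OF cop Q'_pos pos] sq by (simp only: eq)
    have p_x_sq: "sum_of_two_squares (int p * (x + 1))"
    proof (rule sum_of_two_squares_coprime_factor[OF _ pos Q'_pos])
      show "coprime (int p * (x + 1)) Q'" using cop by (simp only: coprime_commute)
      show "sum_of_two_squares (int p * (x + 1) * Q')"
        using sq by (simp only: eq mult.commute[of Q'])
    qed
    have "odd Q" using Q_mod by presburger
    hence "odd Q'" unfolding Q by simp
    hence "Q' mod 4 = 1" using Q'_sq odd_sum_of_two_squares_mod_4 by blast
    hence "int p mod 4 = 1" using Q_mod unfolding Q by (metis mod_mult_right_eq mult.right_neutral)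
    hence "p mod 4 = 1" by presburger
    hence p_sq: "sum_of_two_squares (int p)"
      by (rule prime_cong_1_mod_4_imp_sum_of_two_squares[OF p(1)])
    show ?thesis
      using p(1) by (intro sum_of_two_squares_cancel_prime[OF _ p_sq p_x_sq]) simp
  qed
qed

lemma sum_of_two_squares_odd_power_plus_one:
  fixes x :: int and m :: nat
  assumes "x > 0" "[x = 1] (mod 8)" "odd m" "sum_of_two_squares (x ^ m + 1)"
  shows "sum_of_two_squares (x + 1)"
  using assms(3,4)
proof (induction m rule: less_induct)
  case (less m)
  show ?case
  proof (cases "m = 1")
    case True
    thus ?thesis using less.prems by simp
  next
    case False
    then obtain p where p: "prime p" "p dvd m" using prime_factor_nat by blast
    then obtain k where k: "m = k * p" by (metis dvdE mult.commute)
    have odd: "odd p" "odd k" using less.prems k by auto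
    have "sum_of_two_squares (x ^ k + 1)"
    proof (rule sum_of_two_squares_prime_power_plus_one)
      show "[x ^ k = 1] (mod 8)" using assms(2) cong_pow[of x 1 8 k] by simp
      show "sum_of_two_squares ((x ^ k) ^ p + 1)"
        using less.prems k by (simp add: power_mult)
    qed (use assms(1) p odd in auto)
    moreover have "k < m" using k odd_pos[OF odd(2)] prime_gt_1_nat[OF p(1)] by simp
    ultimately show ?thesis using less.IH odd by blast
  qed
qed

theorem theorem1p4:
  fixes a :: int and n :: nat
  assumes "a > 0"
    and "[a = 1] (mod 8)"
    and "n > 0"
    and "odd n"
    and "sum_of_two_squares (a ^ n + 1)"
  shows "\<forall>\<delta>::nat. \<delta> > 0 \<and> \<delta> dvd n \<longrightarrow> sum_of_two_squares (a ^ \<delta> + 1)"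
proof (intro allI impI, elim conjE)
  fix \<delta> :: nat
  assume "\<delta> dvd n"
  then obtain m where m: "n = \<delta> * m" by (rule dvdE)
  show "sum_of_two_squares (a ^ \<delta> + 1)"
  proof (rule sum_of_two_squares_odd_power_plus_one)
    show "[a ^ \<delta> = 1] (mod 8)" using assms(2) cong_pow[of a 1 8 \<delta>] by simp
    show "odd m" using assms(4) m by simp
    show "sum_of_two_squares ((a ^ \<delta>) ^ m + 1)" using assms(5) m by (simp add: power_mult)
  qed (use assms(1) in simp)
qed

end
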